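(* Let $\alpha\in\mathbb{R}/\mathbb{Z}$ be irrational with partial quotients $\{a_n\}$ and convergent denominators $\{q_n\}$. Suppose that, for some $n\ge0$, $q_n$ is present but $q_{n+1}$ is absent. Then $a_{n+2}=1$ and $q_{n+2}$ is present.
   Context: Identify $\alpha$ with its representative in $(0,1)$ and write its continued fraction expansion $\alpha=[a_1,a_2,a_3,\ldots]=1/(a_1+1/(a_2+\cdots))$ with $a_n\in\mathbb{N}$, $a_n\geq 1$. The convergent denominators are $q_0=1$, $q_1=a_1$, $q_n=a_nq_{n-1}+q_{n-2}$ for $n\ge2$. Fix $\varepsilon>0$ not exceeding the Margulis constant of $\mathbb{H}^4$, put $c(\varepsilon)=1/\sqrt{2\cosh(\varepsilon)-2}$, and let $$u_j(r)=c(\varepsilon)\sqrt{4\sin^2(\pi j\alpha)\,r^2+j^2},\qquad \mathscr{B}(r)=\inf_{j\ge1}u_j(r)\qquad(r\ge0,\ j\ge1).$$ An integer $j\ge1$ is called present if $u_j=\mathscr{B}$ on some non-empty open interval; otherwise $j$ is absent. *)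

theory Defs
  imports "HOL-Analysis.Analysis" "HOL-Algebra.Bij" "HOL-Algebra.Generated_Groups"
begin

section \<open>The Margulis constant of hyperbolic 4-space\<close>

text \<open>Hyperbolic 4-space in the upper half-space model.\<close>

definition H4 :: "((real ^ 3) \<times> real) set" where
  "H4 = {p. 0 < snd p}"

definition hyp_dist :: "(real ^ 3) \<times> real \<Rightarrow> (real ^ 3) \<times> real \<Rightarrow> real" where
  "hyp_dist p q = arcosh (1 + (dist p q)\<^sup>2 / (2 * snd p * snd q))"

text \<open>The full isometry group; orientation-reversing isometries are included.  As in
  the theory \<^theory>\<open>HOL-Algebra.Bij\<close>, its elements are extensional functions, that is, they
  are \<^const>\<open>undefined\<close> off the half-space.\<close>

definition Isom_H4 :: "((real ^ 3) \<times> real \<Rightarrow> (real ^ 3) \<times> real) monoid" where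
  "Isom_H4 = BijGroup H4
     \<lparr>carrier := {f \<in> Bij H4. \<forall>p\<in>H4. \<forall>q\<in>H4. hyp_dist (f p) (f q) = hyp_dist p q}\<rparr>"

text \<open>Discreteness in the compact-open topology. For a subgroup it suffices that the
  identity is isolated.\<close>

definition discrete_in_Isom_H4 :: "((real ^ 3) \<times> real \<Rightarrow> (real ^ 3) \<times> real) set \<Rightarrow> bool" where
  "discrete_in_Isom_H4 \<Gamma> \<longleftrightarrow>
     (\<exists>K \<delta>. compact K \<and> K \<subseteq> H4 \<and> 0 < \<delta> \<and>
        (\<forall>\<gamma>\<in>\<Gamma>. (\<forall>p\<in>K. hyp_dist (\<gamma> p) p < \<delta>) \<longrightarrow> \<gamma> = \<one>\<^bsub>Isom_H4\<^esub>))"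

primrec lower_central_series :: "('a, 'b) monoid_scheme \<Rightarrow> nat \<Rightarrow> 'a set" where
  "lower_central_series G 0 = carrier G"
| "lower_central_series G (Suc k) =
     generate G (\<Union>g\<in>carrier G. \<Union>h\<in>lower_central_series G k.
       {g \<otimes>\<^bsub>G\<^esub> h \<otimes>\<^bsub>G\<^esub> inv\<^bsub>G\<^esub> g \<otimes>\<^bsub>G\<^esub> inv\<^bsub>G\<^esub> h})"

definition nilpotent_group :: "('a, 'b) monoid_scheme \<Rightarrow> bool" where
  "nilpotent_group G \<longleftrightarrow> group G \<and> (\<exists>k. lower_central_series G k = {\<one>\<^bsub>G\<^esub>})"

definition virtually_nilpotent :: "('a, 'b) monoid_scheme \<Rightarrow> bool" where
  "virtually_nilpotent G \<longleftrightarrow>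
     group G \<and>
     (\<exists>N. subgroup N G \<and> finite (rcosets\<^bsub>G\<^esub> N) \<and> nilpotent_group (G\<lparr>carrier := N\<rparr>))"

definition margulis_number_H4 :: "real \<Rightarrow> bool" where
  "margulis_number_H4 \<epsilon> \<longleftrightarrow>
     (\<forall>\<Gamma> x. subgroup \<Gamma> Isom_H4 \<and> discrete_in_Isom_H4 \<Gamma> \<and> x \<in> H4 \<longrightarrow>
        virtually_nilpotent
          (Isom_H4\<lparr>carrier := generate Isom_H4 {\<gamma>\<in>\<Gamma>. hyp_dist (\<gamma> x) x \<le> \<epsilon>}\<rparr>))"

text \<open>The set below is non-empty by the Margulis lemma, and it is bounded above: a
  finitely generated lattice is not virtually nilpotent, and for large $\epsilon$ its
  generators move a given point by at most $\epsilon$.\<close>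

definition margulis_constant_H4 :: real where
  "margulis_constant_H4 = Sup {\<epsilon>. 0 < \<epsilon> \<and> margulis_number_H4 \<epsilon>}"

section \<open>Continued fractions\<close>

text \<open>\<open>cf_finite a k m\<close> is the finite continued fraction with the $m$ partial quotients
  $a_k, \ldots, a_{k+m-1}$ and integer part zero.\<close>

fun cf_finite :: "(nat \<Rightarrow> nat) \<Rightarrow> nat \<Rightarrow> nat \<Rightarrow> real" where
  "cf_finite a k 0 = 0"
| "cf_finite a k (Suc m) = 1 / (real (a k) + cf_finite a (Suc k) m)"

text \<open>Partial quotients are indexed from 1; the value \<open>a 0\<close> is irrelevant.\<close>

definition is_cf_expansion :: "real \<Rightarrow> (nat \<Rightarrow> nat) \<Rightarrow> bool" where
  "is_cf_expansion \<alpha> a \<longleftrightarrow> (\<forall>n\<ge>1. 1 \<le> a n) \<and> (\<lambda>m. cf_finite a 1 m) \<longlonglongrightarrow> \<alpha>"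

fun cf_denom :: "(nat \<Rightarrow> nat) \<Rightarrow> nat \<Rightarrow> nat" where
  "cf_denom a 0 = 1"
| "cf_denom a (Suc 0) = a 1"
| "cf_denom a (Suc (Suc n)) = a (n + 2) * cf_denom a (Suc n) + cf_denom a n"

section \<open>The boundary function\<close>

definition c_const :: "real \<Rightarrow> real" where
  "c_const \<epsilon> = 1 / sqrt (2 * cosh \<epsilon> - 2)"

definition u_fun :: "real \<Rightarrow> real \<Rightarrow> nat \<Rightarrow> real \<Rightarrow> real" where
  "u_fun \<alpha> \<epsilon> j r =
     c_const \<epsilon> * sqrt (4 * (sin (pi * real j * \<alpha>))\<^sup>2 * r\<^sup>2 + (real j)\<^sup>2)"

definition B_fun :: "real \<Rightarrow> real \<Rightarrow> real \<Rightarrow> real" where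
  "B_fun \<alpha> \<epsilon> r = (INF j\<in>{1..}. u_fun \<alpha> \<epsilon> j r)"

definition present :: "real \<Rightarrow> real \<Rightarrow> nat \<Rightarrow> bool" where
  "present \<alpha> \<epsilon> j \<longleftrightarrow> 1 \<le> j \<and>
     (\<exists>s t. 0 \<le> s \<and> s < t \<and> (\<forall>r\<in>{s<..<t}. u_fun \<alpha> \<epsilon> j r = B_fun \<alpha> \<epsilon> r))"

definition absent :: "real \<Rightarrow> real \<Rightarrow> nat \<Rightarrow> bool" where
  "absent \<alpha> \<epsilon> j \<longleftrightarrow> 1 \<le> j \<and> \<not> present \<alpha> \<epsilon> j"

end

theory Submission imports Defs begin

text \<open>Up to the factor \<open>c(\<epsilon>)\<close> and the square root, \<open>u\<^sub>j\<close> is the affine function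
  \<open>T \<mapsto> s\<^sub>j T + j\<^sup>2\<close> of \<open>T = r\<^sup>2\<close>, where \<open>s\<^sub>j = 4 sin\<^sup>2(\<pi>j\<alpha>)\<close>.
  So \<open>j\<close> is present exactly if its line carries an edge of the lower envelope of all these lines.

  Write \<open>q, Q, R\<close> for \<open>q\<^sub>n, q\<^sub>n\<^sub>+\<^sub>1, q\<^sub>n\<^sub>+\<^sub>2\<close>, and let \<open>q\<close> be present and \<open>q < Q\<close>.  The best approximation law
  (\<open>slope_conv_min\<close>) says that only convergent denominators can follow \<open>q\<close> on the envelope: every
  other line is both higher at the start and at least as steep as that of the preceding
  convergent denominator.  Lines \<open>j \<ge> 2Q + q\<close> are too high to matter when \<open>q\<close> meets the first
  line of \<open>Q\<close> and \<open>R\<close>.  This rests on the superadditivity of \<open>sin\<^sup>2\<close> below \<open>\<pi>/2\<close>.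
  The approximation errors satisfy \<open>|err n| = a\<^sub>n\<^sub>+\<^sub>2 |err (n+1)| + |err (n+2)|\<close>, so if
  \<open>a\<^sub>n\<^sub>+\<^sub>2 \<ge> 2\<close> then \<open>2 s\<^sub>Q \<le> s\<^sub>q\<close>, and if \<open>a\<^sub>n\<^sub>+\<^sub>2 = 1\<close> then \<open>s\<^sub>Q + s\<^sub>R \<le> s\<^sub>q\<close>.  In either case
  one of the lines of \<open>Q\<close> and \<open>R\<close> has at most half the slope of the line of \<open>q\<close>, and it
  meets that line below the height \<open>(2Q + q)\<^sup>2\<close>.

  If \<open>a\<^sub>n\<^sub>+\<^sub>2 \<ge> 2\<close> then \<open>R \<ge> 2Q + q\<close>, so \<open>Q\<close> is the next vertex after \<open>q\<close>
  (\<open>present_next_if_big_quotient\<close>).  If \<open>a\<^sub>n\<^sub>+\<^sub>2 = 1\<close> then \<open>q\<^sub>n\<^sub>+\<^sub>3 \<ge> 2Q + q\<close>, so the line that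
  takes over from \<open>q\<close> is that of \<open>Q\<close> or that of \<open>R\<close> (\<open>present_next_or_second\<close>).\<close>

section \<open>Presence as minimality of lines\<close>

definition slope :: "real \<Rightarrow> nat \<Rightarrow> real" where
  "slope \<alpha> j = 4 * (sin (pi * real j * \<alpha>))\<^sup>2"

definition line :: "real \<Rightarrow> nat \<Rightarrow> real \<Rightarrow> real" where
  "line \<alpha> j T = slope \<alpha> j * T + (real j)\<^sup>2"

definition lowest_at :: "real \<Rightarrow> nat \<Rightarrow> real \<Rightarrow> bool" where
  "lowest_at \<alpha> k T \<longleftrightarrow> (\<forall>j\<ge>1. line \<alpha> k T \<le> line \<alpha> j T)"

lemma slope_nonneg: "0 \<le> slope \<alpha> j"
  by (simp add: slope_def)

lemma c_const_pos:
  assumes "0 < \<epsilon>"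
  shows "0 < c_const \<epsilon>"
proof -
  have "cosh 0 < cosh \<epsilon>"
    using assms by (subst cosh_real_strict_mono) auto
  then show ?thesis by (simp add: c_const_def)
qed

lemma u_fun_eq_line: "u_fun \<alpha> \<epsilon> j r = c_const \<epsilon> * sqrt (line \<alpha> j (r\<^sup>2))"
  by (simp add: u_fun_def line_def slope_def)

lemma u_fun_le_iff:
  assumes "0 < \<epsilon>"
  shows "u_fun \<alpha> \<epsilon> k r \<le> u_fun \<alpha> \<epsilon> j r \<longleftrightarrow> line \<alpha> k (r\<^sup>2) \<le> line \<alpha> j (r\<^sup>2)"
  using c_const_pos[OF assms] by (simp add: u_fun_eq_line)

lemma u_fun_eq_B_iff:
  assumes "0 < \<epsilon>" "1 \<le> k"
  shows "u_fun \<alpha> \<epsilon> k r = B_fun \<alpha> \<epsilon> r \<longleftrightarrow> lowest_at \<alpha> k (r\<^sup>2)"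
proof
  assume eq: "u_fun \<alpha> \<epsilon> k r = B_fun \<alpha> \<epsilon> r"
  have bdd: "bdd_below ((\<lambda>j. u_fun \<alpha> \<epsilon> j r) ` {1..})"
    using c_const_pos[OF assms(1)]
    by (intro bdd_belowI2[where m = 0]) (simp add: u_fun_def)
  have "u_fun \<alpha> \<epsilon> k r \<le> u_fun \<alpha> \<epsilon> j r" if "1 \<le> j" for j
    unfolding eq B_fun_def using that by (intro cINF_lower bdd) auto
  then show "lowest_at \<alpha> k (r\<^sup>2)"
    using u_fun_le_iff[OF assms(1)] by (simp add: lowest_at_def)
next
  assume "lowest_at \<alpha> k (r\<^sup>2)"
  then have "u_fun \<alpha> \<epsilon> k r \<le> u_fun \<alpha> \<epsilon> j r" if "1 \<le> j" for j
    using u_fun_le_iff[OF assms(1)] that by (simp add: lowest_at_def)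
  then have "B_fun \<alpha> \<epsilon> r = u_fun \<alpha> \<epsilon> k r"
    unfolding B_fun_def using assms(2) by (intro cInf_eq_minimum) auto
  then show "u_fun \<alpha> \<epsilon> k r = B_fun \<alpha> \<epsilon> r" by simp
qed

lemma present_imp_lowest_at:
  assumes "0 < \<epsilon>" "present \<alpha> \<epsilon> k"
  obtains T where "0 \<le> T" "lowest_at \<alpha> k T"
proof -
  obtain s t where "s < t" and eq: "\<forall>r\<in>{s<..<t}. u_fun \<alpha> \<epsilon> k r = B_fun \<alpha> \<epsilon> r" and k: "1 \<le> k"
    using assms(2) by (auto simp: present_def)
  then have "u_fun \<alpha> \<epsilon> k ((s + t) / 2) = B_fun \<alpha> \<epsilon> ((s + t) / 2)"
    by (auto simp: field_simps)
  then have "lowest_at \<alpha> k (((s + t) / 2)\<^sup>2)"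
    using u_fun_eq_B_iff assms(1) k by blast
  with that show thesis by (meson zero_le_power2)
qed

text \<open>A lowest line at \<open>T\<close> stays lowest just to the right of \<open>T\<close> if no line through the same
  point is flatter.  Only finitely many lines can interfere, because \<open>line \<alpha> j\<close> is at least \<open>j\<^sup>2\<close> on
  the half-line \<open>T \<ge> 0\<close>.\<close>

lemma presentI:
  assumes eps: "0 < \<epsilon>" and k: "1 \<le> k" and T: "0 \<le> T"
    and low: "\<And>j. 1 \<le> j \<Longrightarrow> line \<alpha> k T < line \<alpha> j T \<or>
                 line \<alpha> k T \<le> line \<alpha> j T \<and> slope \<alpha> k \<le> slope \<alpha> j"
  shows "present \<alpha> \<epsilon> k"
proof -
  obtain N :: nat where N: "line \<alpha> k (T + 1) < real N"
    using reals_Archimedean2 by blast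
  have near: "\<forall>\<^sub>F x in at_right T. line \<alpha> k x \<le> line \<alpha> j x" if "1 \<le> j" for j
    using low[OF that]
  proof
    assume less: "line \<alpha> k T < line \<alpha> j T"
    have "((\<lambda>x. line \<alpha> j x - line \<alpha> k x) \<longlongrightarrow> line \<alpha> j T - line \<alpha> k T) (at_right T)"
      unfolding line_def by (intro tendsto_intros)
    then have "\<forall>\<^sub>F x in at_right T. 0 < line \<alpha> j x - line \<alpha> k x"
      using less by (intro order_tendstoD) auto
    then show ?thesis by eventually_elim simp
  next
    assume le: "line \<alpha> k T \<le> line \<alpha> j T \<and> slope \<alpha> k \<le> slope \<alpha> j"
    have "\<forall>\<^sub>F x in at_right T. T < x" by (simp add: eventually_at_right_less)
    then show ?thesis
    proof eventually_elim
      case (elim x)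
      then have "slope \<alpha> k * (x - T) \<le> slope \<alpha> j * (x - T)"
        using le by (intro mult_right_mono) auto
      then show ?case using le by (simp add: line_def algebra_simps)
    qed
  qed
  have "\<forall>\<^sub>F x in at_right T. \<forall>j\<in>{1..<N}. line \<alpha> k x \<le> line \<alpha> j x"
    using near by (intro eventually_ball_finite) auto
  moreover have "\<forall>\<^sub>F x in at_right T. x < T + 1"
    by (rule eventually_at_rightI[where b = "T + 1"]) auto
  moreover have "\<forall>\<^sub>F x in at_right T. T < x"
    by (simp add: eventually_at_right_less)
  ultimately have "\<forall>\<^sub>F x in at_right T. lowest_at \<alpha> k x"
  proof eventually_elim
    case (elim x)
    have "line \<alpha> k x \<le> line \<alpha> j x" if "N \<le> j" "1 \<le> j" for j
    proof -
      have "line \<alpha> k x \<le> line \<alpha> k (T + 1)"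
        using elim slope_nonneg[of \<alpha> k] by (simp add: line_def mult_left_mono)
      also have "\<dots> \<le> real j" using N that by simp
      also have "\<dots> \<le> (real j)\<^sup>2" using that by (simp add: self_le_power)
      also have "\<dots> \<le> line \<alpha> j x"
        using elim T slope_nonneg[of \<alpha> j] by (simp add: line_def)
      finally show ?thesis .
    qed
    with elim show ?case
      by (metis atLeastLessThan_iff lowest_at_def not_le)
  qed
  then obtain b where b: "T < b" "\<And>x. T < x \<Longrightarrow> x < b \<Longrightarrow> lowest_at \<alpha> k x"
    by (auto simp: eventually_at_right_field)
  have "lowest_at \<alpha> k (r\<^sup>2)" if "sqrt T < r" "r < sqrt b" for r
  proof (rule b(2))
    have "0 \<le> r" using that(1) T by (meson order.strict_trans1 order.strict_implies_order real_sqrt_ge_zero)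
    show "T < r\<^sup>2" using that(1) T \<open>0 \<le> r\<close> real_less_lsqrt real_le_rsqrt
      by (metis not_le real_sqrt_le_iff real_sqrt_abs abs_of_nonneg)
    show "r\<^sup>2 < b" using that(2) \<open>0 \<le> r\<close> by (metis not_le real_le_rsqrt real_sqrt_le_iff real_sqrt_abs abs_of_nonneg)
  qed
  then have "\<forall>r\<in>{sqrt T<..<sqrt b}. u_fun \<alpha> \<epsilon> k r = B_fun \<alpha> \<epsilon> r"
    using u_fun_eq_B_iff[OF eps k] by auto
  moreover have "0 \<le> sqrt T" "sqrt T < sqrt b" using T b(1) by auto
  ultimately show ?thesis using k unfolding present_def by blast
qed

section \<open>Convergents and approximation errors\<close>

fun cf_num :: "(nat \<Rightarrow> nat) \<Rightarrow> nat \<Rightarrow> nat" where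
  "cf_num a 0 = 0"
| "cf_num a (Suc 0) = 1"
| "cf_num a (Suc (Suc n)) = a (n + 2) * cf_num a (Suc n) + cf_num a n"

definition err :: "real \<Rightarrow> (nat \<Rightarrow> nat) \<Rightarrow> nat \<Rightarrow> real" where
  "err \<alpha> a k = real (cf_denom a k) * \<alpha> - real (cf_num a k)"

text \<open>The complete quotient with index \<open>k\<close> is \<open>[a\<^sub>k\<^sub>+\<^sub>1, a\<^sub>k\<^sub>+\<^sub>2, \<dots>]\<close>, an orbit of the Gauss map.\<close>

primrec complete_quotient :: "real \<Rightarrow> (nat \<Rightarrow> nat) \<Rightarrow> nat \<Rightarrow> real" where
  "complete_quotient \<alpha> a 0 = \<alpha>"
| "complete_quotient \<alpha> a (Suc k) = 1 / complete_quotient \<alpha> a k - real (a (Suc k))"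

lemma cf_finite_bounds:
  assumes "\<forall>n\<ge>1. 1 \<le> a n" "1 \<le> k"
  shows "0 \<le> cf_finite a k m \<and> cf_finite a k m \<le> 1"
  using assms(2)
proof (induction m arbitrary: k)
  case (Suc m)
  have "1 \<le> real (a k)" using assms(1) Suc.prems by (simp add: Suc_leI)
  moreover have "0 \<le> cf_finite a (Suc k) m" using Suc.IH[of "Suc k"] by simp
  ultimately show ?case by simp
qed auto

lemma complete_quotient_tendsto:
  assumes "\<alpha> \<notin> \<rat>" "is_cf_expansion \<alpha> a"
  shows "complete_quotient \<alpha> a k \<notin> \<rat> \<and>
    (\<lambda>m. cf_finite a (Suc k) m) \<longlonglongrightarrow> complete_quotient \<alpha> a k"
proof (induction k)
  case 0
  then show ?case using assms by (simp add: is_cf_expansion_def)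
next
  case (Suc k)
  let ?\<beta> = "complete_quotient \<alpha> a k"
  have irr: "?\<beta> \<notin> \<rat>" and lim: "(\<lambda>m. cf_finite a (Suc k) m) \<longlonglongrightarrow> ?\<beta>" using Suc by auto
  have nz: "?\<beta> \<noteq> 0" using irr by (metis Rats_0)
  have "1 / ?\<beta> - real (a (Suc k)) \<notin> \<rat>"
  proof
    assume "1 / ?\<beta> - real (a (Suc k)) \<in> \<rat>"
    then have "1 / (1 / ?\<beta> - real (a (Suc k)) + real (a (Suc k))) \<in> \<rat>"
      by (intro Rats_divide Rats_add) auto
    then show False using irr by simp
  qed
  moreover have "(\<lambda>m. 1 / cf_finite a (Suc k) (Suc m) - real (a (Suc k)))
      \<longlonglongrightarrow> 1 / ?\<beta> - real (a (Suc k))"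
    using nz LIMSEQ_Suc[OF lim] by (intro tendsto_intros)
  ultimately show ?case by simp
qed

lemma complete_quotient_bounds:
  assumes "\<alpha> \<notin> \<rat>" "is_cf_expansion \<alpha> a"
  shows "0 < complete_quotient \<alpha> a k" "complete_quotient \<alpha> a k < 1"
proof -
  let ?\<beta> = "complete_quotient \<alpha> a k"
  have irr: "?\<beta> \<notin> \<rat>" and lim: "(\<lambda>m. cf_finite a (Suc k) m) \<longlonglongrightarrow> ?\<beta>"
    using complete_quotient_tendsto[OF assms] by auto
  have bounds: "0 \<le> cf_finite a (Suc k) m \<and> cf_finite a (Suc k) m \<le> 1" for m
    using assms(2) by (intro cf_finite_bounds) (auto simp: is_cf_expansion_def)
  have "0 \<le> ?\<beta>" using bounds by (intro LIMSEQ_le_const[OF lim]) auto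
  moreover have "?\<beta> \<le> 1" using bounds by (intro LIMSEQ_le_const2[OF lim]) auto
  moreover have "?\<beta> \<noteq> 0" "?\<beta> \<noteq> 1" using irr by auto
  ultimately show "0 < ?\<beta>" "?\<beta> < 1" by auto
qed

lemma err_Suc_Suc:
  "err \<alpha> a (Suc (Suc k)) = real (a (k + 2)) * err \<alpha> a (Suc k) + err \<alpha> a k"
  by (simp add: err_def algebra_simps)

lemma err_Suc:
  assumes "\<alpha> \<notin> \<rat>" "is_cf_expansion \<alpha> a"
  shows "err \<alpha> a (Suc k) = - err \<alpha> a k * complete_quotient \<alpha> a (Suc k)"
proof (induction k)
  case 0
  have "\<alpha> \<noteq> 0" using assms(1) by auto
  then show ?case by (simp add: err_def field_simps)
next
  case (Suc k)
  let ?\<beta> = "complete_quotient \<alpha> a (Suc k)"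
  have "?\<beta> \<noteq> 0" using complete_quotient_bounds[OF assms, of "Suc k"] by simp
  then have "err \<alpha> a k = - err \<alpha> a (Suc k) / ?\<beta>"
    using Suc.IH by simp
  then have "err \<alpha> a (Suc (Suc k)) = - err \<alpha> a (Suc k) * (1 / ?\<beta> - real (a (k + 2)))"
    unfolding err_Suc_Suc by (simp add: algebra_simps)
  then show ?case by simp
qed

lemma err_nonzero:
  assumes "\<alpha> \<notin> \<rat>" "is_cf_expansion \<alpha> a"
  shows "err \<alpha> a k \<noteq> 0"
proof (induction k)
  case 0
  then show ?case using assms(1) by (auto simp: err_def)
next
  case (Suc k)
  then show ?case
    using err_Suc[OF assms, of k] complete_quotient_bounds[OF assms, of "Suc k"] by simp
qed

lemma err_alternates:
  assumes "\<alpha> \<notin> \<rat>" "is_cf_expansion \<alpha> a"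
  shows "err \<alpha> a k * err \<alpha> a (Suc k) < 0"
proof -
  have "0 < (err \<alpha> a k)\<^sup>2 * complete_quotient \<alpha> a (Suc k)"
    using err_nonzero[OF assms] complete_quotient_bounds(1)[OF assms]
    by (intro mult_pos_pos) (simp_all del: complete_quotient.simps)
  then show ?thesis unfolding err_Suc[OF assms] by (simp add: power2_eq_square)
qed

lemma abs_err_decreasing:
  assumes "\<alpha> \<notin> \<rat>" "is_cf_expansion \<alpha> a"
  shows "\<bar>err \<alpha> a (Suc k)\<bar> < \<bar>err \<alpha> a k\<bar>"
proof -
  have "\<bar>err \<alpha> a k\<bar> * complete_quotient \<alpha> a (Suc k) < \<bar>err \<alpha> a k\<bar> * 1"
    using err_nonzero[OF assms] complete_quotient_bounds(2)[OF assms]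
    by (intro mult_strict_left_mono) (simp_all del: complete_quotient.simps)
  then show ?thesis
    using complete_quotient_bounds(1)[OF assms, of "Suc k"]
    by (simp add: err_Suc[OF assms] abs_mult del: complete_quotient.simps)
qed

lemma abs_err_recurrence:
  assumes "\<alpha> \<notin> \<rat>" "is_cf_expansion \<alpha> a"
  shows "\<bar>err \<alpha> a k\<bar> = real (a (k + 2)) * \<bar>err \<alpha> a (Suc k)\<bar> + \<bar>err \<alpha> a (Suc (Suc k))\<bar>"
proof (cases "0 < err \<alpha> a k")
  case True
  then have "err \<alpha> a (Suc k) < 0" "0 < err \<alpha> a (Suc (Suc k))"
    using err_alternates[OF assms, of k] err_alternates[OF assms, of "Suc k"]
    by (auto simp: mult_less_0_iff)
  with True show ?thesis using err_Suc_Suc[of \<alpha> a k] by simp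
next
  case False
  then have "err \<alpha> a k < 0" "0 < err \<alpha> a (Suc k)" "err \<alpha> a (Suc (Suc k)) < 0"
    using err_alternates[OF assms, of k] err_alternates[OF assms, of "Suc k"]
    by (auto simp: mult_less_0_iff)
  then show ?thesis using err_Suc_Suc[of \<alpha> a k] by simp
qed

lemma convergent_determinant:
  "int (cf_num a (Suc k)) * int (cf_denom a k) - int (cf_num a k) * int (cf_denom a (Suc k))
     = (-1) ^ k"
proof (induction k)
  case (Suc k)
  have "int (cf_num a (Suc (Suc k))) * int (cf_denom a (Suc k))
      - int (cf_num a (Suc k)) * int (cf_denom a (Suc (Suc k)))
    = - (int (cf_num a (Suc k)) * int (cf_denom a k) - int (cf_num a k) * int (cf_denom a (Suc k)))"
    by (simp add: algebra_simps)
  then show ?case using Suc.IH by simp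
qed simp

lemma cf_denom_pos:
  assumes "\<forall>n\<ge>1. 1 \<le> a n"
  shows "1 \<le> cf_denom a k"
  using assms
proof (induction a k rule: cf_denom.induct)
  case (3 a n)
  then show ?case by (simp add: trans_le_add2)
qed auto

lemma cf_denom_mono:
  assumes "\<forall>n\<ge>1. 1 \<le> a n"
  shows "cf_denom a k \<le> cf_denom a (Suc k)"
proof (cases k)
  case 0
  then show ?thesis using assms by simp
next
  case (Suc m)
  have "1 * cf_denom a k \<le> a (m + 2) * cf_denom a k" using assms by (intro mult_right_mono) auto
  also have "\<dots> \<le> cf_denom a (Suc k)" using Suc by simp
  finally show ?thesis by simp
qed

text \<open>The best approximation law.  As consecutive convergents form a basis of \<open>\<int>\<^sup>2\<close>, write
  \<open>(j, i)\<close> in it with coordinates \<open>u\<close> and \<open>v\<close>.  The bounds on \<open>j\<close> force \<open>u\<close> and \<open>v\<close> to have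
  opposite signs.  The errors of consecutive convergents alternate in sign too, so the two
  contributions to \<open>j\<alpha> - i\<close> add up instead of cancelling.\<close>

lemma best_approximation:
  assumes "\<alpha> \<notin> \<rat>" "is_cf_expansion \<alpha> a" "1 \<le> j" "j < cf_denom a (Suc k)"
  shows "\<bar>err \<alpha> a k\<bar> \<le> \<bar>real j * \<alpha> - of_int i\<bar>"
proof -
  define p P q Q where "p = int (cf_num a k)" and "P = int (cf_num a (Suc k))"
    and "q = int (cf_denom a k)" and "Q = int (cf_denom a (Suc k))"
  define d :: int where "d = (-1) ^ k"
  define u where "u = d * (P * int j - Q * i)"
  define v where "v = d * (q * i - p * int j)"
  have det: "P * q - p * Q = d"
    using convergent_determinant[of a k] by (simp add: p_def P_def q_def Q_def d_def)
  have dd: "d * d = 1" by (simp add: d_def flip: power_mult_distrib)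
  have "u * q + v * Q = d * (P * q - p * Q) * int j" by (simp add: u_def v_def algebra_simps)
  then have j: "int j = u * q + v * Q" using det dd by simp
  have "u * p + v * P = d * (P * q - p * Q) * i" by (simp add: u_def v_def algebra_simps)
  then have i: "i = u * p + v * P" using det dd by simp
  have q: "1 \<le> q" and Q: "1 \<le> Q"
    using cf_denom_pos[of a] assms(2) by (auto simp: is_cf_expansion_def q_def Q_def Suc_le_eq)
  have jQ: "0 < int j" "int j < Q" using assms by (auto simp: Q_def)
  have u0: "u \<noteq> 0"
  proof
    assume "u = 0"
    then have "0 < v * Q" "v * Q < 1 * Q" using j jQ by auto
    then have "0 < v" "v < 1" using Q by (simp_all add: zero_less_mult_iff)
    then show False by simp
  qed
  have uv: "u * v \<le> 0"
  proof (rule ccontr)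
    assume "\<not> u * v \<le> 0"
    then consider "1 \<le> u" "1 \<le> v" | "u \<le> -1" "v \<le> -1" by (auto simp: zero_less_mult_iff mult_le_0_iff not_le)
    then show False
    proof cases
      case 1
      then have "0 \<le> u * q" "1 * Q \<le> v * Q" using q Q by (auto intro!: mult_right_mono)
      then show False using j jQ by simp
    next
      case 2
      then have "u * q \<le> 0" "v * Q \<le> 0" using q Q by (auto simp: mult_le_0_iff)
      then show False using j jQ by simp
    qed
  qed
  let ?x = "of_int u * err \<alpha> a k" and ?y = "of_int v * err \<alpha> a (Suc k)"
  have rj: "real j = of_int u * real (cf_denom a k) + of_int v * real (cf_denom a (Suc k))"
    using arg_cong[OF j, of real_of_int] by (simp add: q_def Q_def)
  have ri: "of_int i = of_int u * real (cf_num a k) + of_int v * real (cf_num a (Suc k))"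
    using arg_cong[OF i, of real_of_int] by (simp add: p_def P_def)
  have sum: "real j * \<alpha> - of_int i = ?x + ?y"
    unfolding rj ri err_def by (simp add: algebra_simps)
  have "?x * ?y = of_int (u * v) * (err \<alpha> a k * err \<alpha> a (Suc k))" by simp
  moreover have "0 \<le> \<dots>"
    using uv err_alternates[OF assms(1,2), of k]
    by (intro mult_nonpos_nonpos) (auto simp flip: of_int_mult)
  ultimately have "0 \<le> ?x * ?y" by (simp only:)
  moreover have "\<bar>x\<bar> \<le> \<bar>x + y\<bar>" if "0 \<le> x * y" for x y :: real
    using that by (auto simp: zero_le_mult_iff)
  ultimately have "\<bar>?x\<bar> \<le> \<bar>?x + ?y\<bar>" by blast
  moreover have "1 \<le> \<bar>real_of_int u\<bar>" using u0 by linarith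
  then have "1 * \<bar>err \<alpha> a k\<bar> \<le> \<bar>real_of_int u\<bar> * \<bar>err \<alpha> a k\<bar>" by (intro mult_right_mono) auto
  ultimately show ?thesis unfolding sum by (simp add: abs_mult)
qed

section \<open>Slopes at the convergent denominators\<close>

lemma slope_eq_shifted: "slope \<alpha> j = 4 * (sin (pi * \<bar>real j * \<alpha> - of_int i\<bar>))\<^sup>2"
proof -
  have "pi * (real j * \<alpha> - of_int i) = pi * real j * \<alpha> - pi * of_int i"
    by (simp add: algebra_simps)
  then have "(sin (pi * (real j * \<alpha> - of_int i)))\<^sup>2 = (sin (pi * real j * \<alpha>))\<^sup>2 * (cos (pi * of_int i))\<^sup>2"
    by (simp add: sin_diff power_mult_distrib sin_npi_int)
  moreover have "(cos (pi * of_int i))\<^sup>2 = 1"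
    using sin_cos_squared_add[of "pi * of_int i"] by (simp add: sin_npi_int)
  moreover have "(sin (pi * \<bar>x\<bar>))\<^sup>2 = (sin (pi * x))\<^sup>2" for x :: real by (simp add: abs_if)
  ultimately show ?thesis by (simp add: slope_def)
qed

lemma slope_conv: "slope \<alpha> (cf_denom a k) = 4 * (sin (pi * \<bar>err \<alpha> a k\<bar>))\<^sup>2"
  using slope_eq_shifted[of \<alpha> "cf_denom a k" "int (cf_num a k)"] by (simp add: err_def)

lemma sin_pi_mono:
  assumes "0 \<le> x" "x \<le> y" "y \<le> 1 / 2"
  shows "(sin (pi * x))\<^sup>2 \<le> (sin (pi * y))\<^sup>2"
proof (rule power_mono)
  have "pi * x \<le> pi * y" "pi * y \<le> pi * (1/2)" "0 \<le> pi * x"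
    using assms by (auto intro!: mult_left_mono)
  then show "sin (pi * x) \<le> sin (pi * y)" "0 \<le> sin (pi * x)"
    by (intro sin_monotone_2pi_le sin_ge_zero; linarith)+
qed

lemma slope_conv_min:
  assumes "\<alpha> \<notin> \<rat>" "is_cf_expansion \<alpha> a" "1 \<le> j" "j < cf_denom a (Suc k)"
  shows "slope \<alpha> (cf_denom a k) \<le> slope \<alpha> j"
proof -
  have "\<bar>err \<alpha> a k\<bar> \<le> \<bar>real j * \<alpha> - of_int (round (real j * \<alpha>))\<bar>"
    using assms by (rule best_approximation)
  moreover have "\<bar>real j * \<alpha> - of_int (round (real j * \<alpha>))\<bar> \<le> 1 / 2"
    using of_int_round_abs_le[of "real j * \<alpha>"] by (simp add: abs_minus_commute)
  ultimately show ?thesis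
    unfolding slope_conv slope_eq_shifted[of \<alpha> j "round (real j * \<alpha>)"]
    using sin_pi_mono[of "\<bar>err \<alpha> a k\<bar>"] by simp
qed

lemma abs_err_le_half:
  assumes "\<alpha> \<notin> \<rat>" "is_cf_expansion \<alpha> a" "1 < cf_denom a (Suc k)"
  shows "\<bar>err \<alpha> a k\<bar> \<le> 1 / 2"
  using best_approximation[OF assms(1,2) _ assms(3), of "round \<alpha>"] of_int_round_abs_le[of \<alpha>]
  by (simp add: abs_minus_commute)

text \<open>The difference of the two sides is \<open>2 sin A sin B cos (A + B)\<close> with \<open>A = \<pi>x\<close> and
  \<open>B = \<pi>y\<close>.\<close>

lemma sin_pi_superadditive:
  assumes "0 \<le> x" "0 \<le> y" "x + y \<le> 1 / 2"
  shows "(sin (pi * x))\<^sup>2 + (sin (pi * y))\<^sup>2 \<le> (sin (pi * (x + y)))\<^sup>2"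
proof -
  let ?A = "pi * x" and ?B = "pi * y"
  have sum: "?A + ?B \<le> pi / 2"
    using mult_left_mono[OF assms(3), of pi] by (simp add: algebra_simps)
  have nn: "0 \<le> ?A" "0 \<le> ?B" using assms by auto
  have "0 \<le> sin ?A" "0 \<le> sin ?B" "0 \<le> cos (?A + ?B)"
    by (intro sin_ge_zero cos_ge_zero; use nn sum in linarith)+
  then have pos: "0 \<le> 2 * sin ?A * sin ?B * cos (?A + ?B)" by simp
  have c: "(cos z)\<^sup>2 = 1 - (sin z)\<^sup>2" for z :: real by (simp add: cos_squared_eq)
  have "(sin (?A + ?B))\<^sup>2 = (sin ?A)\<^sup>2 * (cos ?B)\<^sup>2 + (cos ?A)\<^sup>2 * (sin ?B)\<^sup>2
      + 2 * sin ?A * sin ?B * (cos ?A * cos ?B)"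
    by (simp add: sin_add power2_eq_square algebra_simps)
  also have "\<dots> = (sin ?A)\<^sup>2 + (sin ?B)\<^sup>2 + 2 * sin ?A * sin ?B * cos (?A + ?B)"
    unfolding c cos_add by (simp add: power2_eq_square algebra_simps)
  finally show ?thesis using pos by (simp add: distrib_left)
qed

lemma slope_conv_decreasing:
  assumes "\<alpha> \<notin> \<rat>" "is_cf_expansion \<alpha> a" "1 < cf_denom a (Suc k)"
  shows "slope \<alpha> (cf_denom a (Suc k)) < slope \<alpha> (cf_denom a k)"
proof -
  have "pi * \<bar>err \<alpha> a (Suc k)\<bar> < pi * \<bar>err \<alpha> a k\<bar>" "pi * \<bar>err \<alpha> a k\<bar> \<le> pi * (1 / 2)"
    using abs_err_decreasing[OF assms(1,2)] abs_err_le_half[OF assms] by (auto intro!: mult_left_mono)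
  then have "sin (pi * \<bar>err \<alpha> a (Suc k)\<bar>) < sin (pi * \<bar>err \<alpha> a k\<bar>)"
      "0 \<le> sin (pi * \<bar>err \<alpha> a (Suc k)\<bar>)"
    by (auto intro!: sin_monotone_2pi sin_ge_zero intro: order_trans[of _ 0])
  then show ?thesis unfolding slope_conv by (simp add: power_strict_mono)
qed

text \<open>A partial quotient of at least 2 makes \<open>|err k|\<close> at least twice \<open>|err (k+1)|\<close>, and doubling an
  argument at least doubles \<open>sin\<^sup>2\<close> by superadditivity.\<close>

lemma slope_halves_if_big_quotient:
  assumes "\<alpha> \<notin> \<rat>" "is_cf_expansion \<alpha> a" "1 < cf_denom a (Suc k)" "2 \<le> a (k + 2)"
  shows "2 * slope \<alpha> (cf_denom a (Suc k)) \<le> slope \<alpha> (cf_denom a k)"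
proof -
  let ?x = "\<bar>err \<alpha> a k\<bar>" and ?y = "\<bar>err \<alpha> a (Suc k)\<bar>"
  have "2 * ?y \<le> real (a (k + 2)) * ?y" using assms(4) by (intro mult_right_mono) auto
  then have xy: "?y + ?y \<le> ?x" using abs_err_recurrence[OF assms(1,2), of k] by simp
  have half: "?x \<le> 1 / 2" using assms by (intro abs_err_le_half)
  have "(sin (pi * ?y))\<^sup>2 + (sin (pi * ?y))\<^sup>2 \<le> (sin (pi * (?y + ?y)))\<^sup>2"
    using xy half by (intro sin_pi_superadditive) auto
  also have "\<dots> \<le> (sin (pi * ?x))\<^sup>2" using xy half by (intro sin_pi_mono) auto
  finally show ?thesis unfolding slope_conv by simp
qed

lemma slope_superadditive_if_unit_quotient:
  assumes "\<alpha> \<notin> \<rat>" "is_cf_expansion \<alpha> a" "1 < cf_denom a (Suc k)" "a (k + 2) = 1"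
  shows "slope \<alpha> (cf_denom a (Suc k)) + slope \<alpha> (cf_denom a (Suc (Suc k))) \<le> slope \<alpha> (cf_denom a k)"
proof -
  have "\<bar>err \<alpha> a k\<bar> = \<bar>err \<alpha> a (Suc k)\<bar> + \<bar>err \<alpha> a (Suc (Suc k))\<bar>"
    using abs_err_recurrence[OF assms(1,2), of k] assms(4) by simp
  then show ?thesis
    using abs_err_le_half[OF assms(1-3)]
      sin_pi_superadditive[of "\<bar>err \<alpha> a (Suc k)\<bar>" "\<bar>err \<alpha> a (Suc (Suc k))\<bar>"]
    unfolding slope_conv by simp
qed

section \<open>The successor of a present convergent denominator\<close>

definition crossing :: "real \<Rightarrow> nat \<Rightarrow> nat \<Rightarrow> real" where
  "crossing \<alpha> q k = ((real k)\<^sup>2 - (real q)\<^sup>2) / (slope \<alpha> q - slope \<alpha> k)"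

lemma line_le_iff_crossing:
  assumes "slope \<alpha> k < slope \<alpha> q"
  shows "line \<alpha> q T \<le> line \<alpha> k T \<longleftrightarrow> T \<le> crossing \<alpha> q k"
    and "line \<alpha> k T \<le> line \<alpha> q T \<longleftrightarrow> crossing \<alpha> q k \<le> T"
  using assms by (auto simp: line_def crossing_def field_simps)

lemma line_le_mono:
  assumes "line \<alpha> k S \<le> line \<alpha> j S" "slope \<alpha> k \<le> slope \<alpha> j" "S \<le> T"
  shows "line \<alpha> k T \<le> line \<alpha> j T"
proof -
  have "slope \<alpha> k * (T - S) \<le> slope \<alpha> j * (T - S)" using assms by (intro mult_right_mono) auto
  then show ?thesis using assms(1) by (simp add: line_def algebra_simps)
qed

lemma line_le_if_both_le:
  assumes "k \<le> j" "slope \<alpha> k \<le> slope \<alpha> j" "0 \<le> T"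
  shows "line \<alpha> k T \<le> line \<alpha> j T"
  using line_le_mono[of \<alpha> k 0 j T] assms by (simp add: line_def)

text \<open>If the line of \<open>k\<close> is at most half as steep as that of \<open>q\<close>, then on the way to their
  crossing the latter rises by at most twice \<open>k\<^sup>2 - q\<^sup>2\<close>.\<close>

lemma line_at_crossing_le:
  assumes "2 * slope \<alpha> k \<le> slope \<alpha> q" "slope \<alpha> k < slope \<alpha> q" "q \<le> k" "T \<le> crossing \<alpha> q k"
  shows "line \<alpha> q T \<le> 2 * (real k)\<^sup>2 - (real q)\<^sup>2"
proof -
  let ?C = "crossing \<alpha> q k"
  have "(real q)\<^sup>2 \<le> (real k)\<^sup>2" using assms(3) by (simp add: power_mono)
  then have C: "0 \<le> ?C" using assms(2) by (simp add: crossing_def)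
  have "slope \<alpha> q * T \<le> slope \<alpha> q * ?C"
    using assms(4) by (intro mult_left_mono slope_nonneg)
  also have "\<dots> \<le> 2 * (slope \<alpha> q - slope \<alpha> k) * ?C"
    using assms(1) C by (intro mult_right_mono) auto
  also have "\<dots> = 2 * ((real k)\<^sup>2 - (real q)\<^sup>2)"
    using assms(2) unfolding crossing_def by (subst mult.assoc) simp
  finally show ?thesis by (simp add: line_def)
qed

lemma line_less_if_far:
  assumes "h < (real M)\<^sup>2" "M \<le> j" "0 \<le> T"
  shows "h < line \<alpha> j T"
proof -
  have "(real M)\<^sup>2 \<le> (real j)\<^sup>2" using assms(2) by (intro power_mono) auto
  moreover have "(real j)\<^sup>2 \<le> line \<alpha> j T" using assms(3) slope_nonneg[of \<alpha> j] by (simp add: line_def)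
  ultimately show ?thesis using assms(1) by linarith
qed

text \<open>Here and below, \<open>T\<close> is a time at or after one at which the line of \<open>q\<^sub>n\<close> is lowest: flatter
  lines may have overtaken it since, but no line \<open>j < q\<^sub>n\<^sub>+\<^sub>1\<close> is flatter.\<close>

lemma conv_line_le_before_next:
  assumes "\<alpha> \<notin> \<rat>" "is_cf_expansion \<alpha> a" "lowest_at \<alpha> (cf_denom a n) S" "S \<le> T"
    and "1 \<le> j" "j < cf_denom a (Suc n)"
  shows "line \<alpha> (cf_denom a n) T \<le> line \<alpha> j T \<and> slope \<alpha> (cf_denom a n) \<le> slope \<alpha> j"
proof -
  have "slope \<alpha> (cf_denom a n) \<le> slope \<alpha> j" using assms by (intro slope_conv_min)
  moreover have "line \<alpha> (cf_denom a n) S \<le> line \<alpha> j S" using assms by (simp add: lowest_at_def)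
  ultimately show ?thesis using line_le_mono assms(4) by blast
qed

lemma conv_line_le_after:
  assumes "\<alpha> \<notin> \<rat>" "is_cf_expansion \<alpha> a" "0 \<le> T" "1 \<le> j"
    and "cf_denom a n \<le> j" "j < cf_denom a (Suc n)"
  shows "line \<alpha> (cf_denom a n) T \<le> line \<alpha> j T \<and> slope \<alpha> (cf_denom a n) \<le> slope \<alpha> j"
  using slope_conv_min[OF assms(1,2,4,6)] line_le_if_both_le assms(3,5) by blast

lemma present_next_if_big_quotient:
  assumes irr: "\<alpha> \<notin> \<rat>" and cf: "is_cf_expansion \<alpha> a" and eps: "0 < \<epsilon>"
    and less: "cf_denom a n < cf_denom a (Suc n)"
    and pres: "present \<alpha> \<epsilon> (cf_denom a n)" and big: "2 \<le> a (n + 2)"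
  shows "present \<alpha> \<epsilon> (cf_denom a (Suc n))"
proof -
  define q Q where "q = cf_denom a n" and "Q = cf_denom a (Suc n)"
  define T where "T = crossing \<alpha> q Q"
  have a: "\<forall>n\<ge>1. 1 \<le> a n" using cf by (simp add: is_cf_expansion_def)
  have q: "1 \<le> q" "q < Q" using cf_denom_pos[OF a] less by (auto simp: q_def Q_def)
  have Q1: "1 < cf_denom a (Suc n)" using q by (simp add: Q_def)
  obtain S where S: "0 \<le> S" "lowest_at \<alpha> q S"
    using present_imp_lowest_at[OF eps pres] by (auto simp: q_def)
  have dec: "slope \<alpha> Q < slope \<alpha> q"
    using slope_conv_decreasing[OF irr cf Q1] by (simp add: q_def Q_def)
  have "S \<le> T"
    using S(2) q line_le_iff_crossing(1)[OF dec, of S] by (simp add: lowest_at_def T_def)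
  then have T: "0 \<le> T" using S by simp
  have Qq: "line \<alpha> Q T \<le> line \<alpha> q T" using line_le_iff_crossing(2)[OF dec] by (simp add: T_def)
  have "line \<alpha> q T \<le> 2 * (real Q)\<^sup>2 - (real q)\<^sup>2"
    using slope_halves_if_big_quotient[OF irr cf Q1 big] dec q
    by (intro line_at_crossing_le) (auto simp: T_def q_def Q_def)
  also have "\<dots> < (real (2 * Q + q))\<^sup>2"
  proof -
    have "0 < (real Q)\<^sup>2" "0 \<le> (real q)\<^sup>2" "0 \<le> real Q * real q" using q by auto
    moreover have "(real (2 * Q + q))\<^sup>2 = 4 * (real Q)\<^sup>2 + 4 * (real Q * real q) + (real q)\<^sup>2"
      by (simp add: power2_eq_square algebra_simps)
    ultimately show ?thesis by linarith
  qed
  finally have height: "line \<alpha> q T < (real (2 * Q + q))\<^sup>2" .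
  have R: "2 * Q + q \<le> cf_denom a (Suc (Suc n))"
    using mult_right_mono[OF big, of Q] by (simp add: q_def Q_def)
  show "present \<alpha> \<epsilon> (cf_denom a (Suc n))" unfolding Q_def[symmetric]
  proof (rule presentI[OF eps _ T])
    fix j :: nat assume j: "1 \<le> j"
    consider "j < Q" | "Q \<le> j" "j < cf_denom a (Suc (Suc n))" | "2 * Q + q \<le> j"
      using R by linarith
    then show "line \<alpha> Q T < line \<alpha> j T \<or> line \<alpha> Q T \<le> line \<alpha> j T \<and> slope \<alpha> Q \<le> slope \<alpha> j"
    proof cases
      case 1
      then show ?thesis
        using conv_line_le_before_next[OF irr cf _ \<open>S \<le> T\<close> j, of n] S Qq dec
        by (simp add: q_def Q_def)
    next
      case 2
      then show ?thesis
        using conv_line_le_after[OF irr cf T j, of "Suc n"] by (simp add: Q_def)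
    next
      case 3
      then show ?thesis using line_less_if_far[OF height _ T, of j \<alpha>] Qq by simp
    qed
  qed (use q in simp)
qed

text \<open>The line that takes over from \<open>q\<^sub>n\<close> is the one of \<open>q\<^sub>n\<^sub>+\<^sub>1\<close> and \<open>q\<^sub>n\<^sub>+\<^sub>2\<close> that it meets
  first.  If it meets both at the same time, the flatter one, \<open>q\<^sub>n\<^sub>+\<^sub>2\<close>, wins.\<close>

lemma present_next_or_second:
  assumes irr: "\<alpha> \<notin> \<rat>" and cf: "is_cf_expansion \<alpha> a" and eps: "0 < \<epsilon>"
    and less: "cf_denom a n < cf_denom a (Suc n)"
    and pres: "present \<alpha> \<epsilon> (cf_denom a n)" and one: "a (n + 2) = 1"
  shows "present \<alpha> \<epsilon> (cf_denom a (Suc n)) \<or> present \<alpha> \<epsilon> (cf_denom a (Suc (Suc n)))"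
proof -
  define q Q R where "q = cf_denom a n" and "Q = cf_denom a (Suc n)"
    and "R = cf_denom a (Suc (Suc n))"
  define T where "T = min (crossing \<alpha> q Q) (crossing \<alpha> q R)"
  have a: "\<forall>n\<ge>1. 1 \<le> a n" using cf by (simp add: is_cf_expansion_def)
  have R: "R = Q + q" using one by (simp add: q_def Q_def R_def)
  have q: "1 \<le> q" "q < Q" "Q < R" using cf_denom_pos[OF a, of n] less R by (auto simp: q_def Q_def)
  have Q1: "1 < cf_denom a (Suc n)" and R1: "1 < cf_denom a (Suc (Suc n))"
    using q by (auto simp: Q_def R_def)
  obtain S where S: "0 \<le> S" "lowest_at \<alpha> q S"
    using present_imp_lowest_at[OF eps pres] by (auto simp: q_def)
  have dec: "slope \<alpha> Q < slope \<alpha> q" "slope \<alpha> R < slope \<alpha> Q" "slope \<alpha> R < slope \<alpha> q"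
    using slope_conv_decreasing[OF irr cf Q1] slope_conv_decreasing[OF irr cf R1]
    by (auto simp: q_def Q_def R_def)
  note cross = line_le_iff_crossing[OF dec(1)] line_le_iff_crossing[OF dec(3)]
  have "line \<alpha> q S \<le> line \<alpha> Q S" "line \<alpha> q S \<le> line \<alpha> R S"
    using S(2) q by (auto simp: lowest_at_def)
  then have "S \<le> T" unfolding cross T_def by simp
  then have T: "0 \<le> T" using S by simp
  have sum: "slope \<alpha> Q + slope \<alpha> R \<le> slope \<alpha> q"
    using slope_superadditive_if_unit_quotient[OF irr cf Q1 one] by (simp add: q_def Q_def R_def)
  have "line \<alpha> q T \<le> 2 * (real R)\<^sup>2 - (real q)\<^sup>2"
  proof (cases "2 * slope \<alpha> Q \<le> slope \<alpha> q")
    case True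
    then have "line \<alpha> q T \<le> 2 * (real Q)\<^sup>2 - (real q)\<^sup>2"
      using dec q by (intro line_at_crossing_le) (auto simp: T_def)
    moreover have "(real Q)\<^sup>2 \<le> (real R)\<^sup>2" using q by (intro power_mono) auto
    ultimately show ?thesis by linarith
  next
    case False
    then show ?thesis using sum dec q by (intro line_at_crossing_le) (auto simp: T_def)
  qed
  also have "\<dots> < (real (2 * Q + q))\<^sup>2"
  proof -
    have "0 < (real Q)\<^sup>2" using q by simp
    moreover have "(real (2 * Q + q))\<^sup>2 = 2 * (real R)\<^sup>2 - (real q)\<^sup>2 + 2 * (real Q)\<^sup>2"
      by (simp add: R power2_eq_square algebra_simps)
    ultimately show ?thesis by linarith
  qed
  finally have height: "line \<alpha> q T < (real (2 * Q + q))\<^sup>2" .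
  have "1 * R \<le> a (n + 3) * R" using a by (intro mult_right_mono) auto
  moreover have "cf_denom a (Suc (Suc (Suc n))) = a (n + 3) * R + Q"
    by (simp add: Q_def R_def eval_nat_numeral)
  ultimately have third: "2 * Q + q \<le> cf_denom a (Suc (Suc (Suc n)))"
    using R by linarith
  have before: "line \<alpha> q T \<le> line \<alpha> j T \<and> slope \<alpha> q \<le> slope \<alpha> j" if "1 \<le> j" "j < Q" for j
    using conv_line_le_before_next[OF irr cf _ \<open>S \<le> T\<close>, of n j] S that by (simp add: q_def Q_def)
  have middle: "line \<alpha> Q T \<le> line \<alpha> j T \<and> slope \<alpha> Q \<le> slope \<alpha> j" if "Q \<le> j" "j < R" for j
    using conv_line_le_after[OF irr cf T, of j "Suc n"] q that by (simp add: Q_def R_def)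
  have after: "line \<alpha> R T \<le> line \<alpha> j T \<and> slope \<alpha> R \<le> slope \<alpha> j"
    if "R \<le> j" "j < cf_denom a (Suc (Suc (Suc n)))" for j
    using conv_line_le_after[OF irr cf T, of j "Suc (Suc n)"] q that by (simp add: R_def)
  have far: "line \<alpha> q T < line \<alpha> j T" if "2 * Q + q \<le> j" for j
    using line_less_if_far[OF height that T] .
  have ranges: "j < Q \<or> (Q \<le> j \<and> j < R) \<or> (R \<le> j \<and> j < cf_denom a (Suc (Suc (Suc n))))
      \<or> 2 * Q + q \<le> j" for j
    using third by linarith
  show ?thesis
  proof (cases "crossing \<alpha> q Q < crossing \<alpha> q R")
    case True
    then have Qq: "line \<alpha> Q T \<le> line \<alpha> q T" and "\<not> line \<alpha> R T \<le> line \<alpha> q T"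
      unfolding cross T_def by auto
    then have QR: "line \<alpha> Q T < line \<alpha> R T" by linarith
    have "present \<alpha> \<epsilon> Q"
    proof (rule presentI[OF eps _ T])
      fix j :: nat assume "1 \<le> j"
      then show "line \<alpha> Q T < line \<alpha> j T \<or> line \<alpha> Q T \<le> line \<alpha> j T \<and> slope \<alpha> Q \<le> slope \<alpha> j"
        using ranges[of j] before[of j] middle[of j] after[of j] far[of j] Qq QR dec by fastforce
    qed (use q in simp)
    then show ?thesis by (simp add: Q_def)
  next
    case False
    then have Rq: "line \<alpha> R T \<le> line \<alpha> q T" and qQ: "line \<alpha> q T \<le> line \<alpha> Q T"
      using cross by (auto simp: T_def)
    have "present \<alpha> \<epsilon> R"
    proof (rule presentI[OF eps _ T])
      fix j :: nat assume "1 \<le> j"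
      then show "line \<alpha> R T < line \<alpha> j T \<or> line \<alpha> R T \<le> line \<alpha> j T \<and> slope \<alpha> R \<le> slope \<alpha> j"
        using ranges[of j] before[of j] middle[of j] after[of j] far[of j] Rq qQ dec by fastforce
    qed (use q in simp)
    then show ?thesis by (simp add: R_def)
  qed
qed

theorem theorem3p7:
  fixes \<alpha> \<epsilon> :: real and a :: "nat \<Rightarrow> nat" and n :: nat
  assumes "0 < \<epsilon>" and "\<epsilon> \<le> margulis_constant_H4"
    and "0 < \<alpha>" and "\<alpha> < 1" and "\<alpha> \<notin> \<rat>"
    and "is_cf_expansion \<alpha> a"
    and "present \<alpha> \<epsilon> (cf_denom a n)"
    and "absent \<alpha> \<epsilon> (cf_denom a (n + 1))"
  shows "a (n + 2) = 1 \<and> present \<alpha> \<epsilon> (cf_denom a (n + 2))"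
proof -
  have a: "\<forall>n\<ge>1. 1 \<le> a n" using assms(6) by (simp add: is_cf_expansion_def)
  have abs: "\<not> present \<alpha> \<epsilon> (cf_denom a (Suc n))" using assms(8) by (simp add: absent_def)
  \<comment> \<open>Equality occurs for \<open>n = 0\<close> and \<open>a\<^sub>1 = 1\<close> only, and then the two denominators cannot differ
    in being present.\<close>
  have "cf_denom a n \<noteq> cf_denom a (Suc n)" using assms(7) abs by metis
  then have less: "cf_denom a n < cf_denom a (Suc n)" using cf_denom_mono[OF a, of n] by linarith
  have "\<not> 2 \<le> a (n + 2)"
    using present_next_if_big_quotient[OF assms(5,6,1) less assms(7)] abs by blast
  moreover have "1 \<le> a (n + 2)" using a by simp
  ultimately have one: "a (n + 2) = 1" by linarith
  then show ?thesis
    using present_next_or_second[OF assms(5,6,1) less assms(7) one] abs by simp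
qed

end
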